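(* Let $G$ be a graph containing a cycle, with girth $g(G)$. Then $L_2(G)\geq \left\lfloor\frac{2g(G)}{3}\right\rfloor$, and for every integer $k$ with $\Delta(G)\geq k\geq 3$ one has $L_k(G)\geq g(G)+k-3$. Moreover, the lower bounds are tight: there is a graph $G$ containing a cycle with $L_2(G)=\left\lfloor\frac{2g(G)}{3}\right\rfloor$, and for every $k\geq 3$ there is a graph $G$ containing a cycle with $\Delta(G)\ge k$ and $L_k(G)=g(G)+k-3$.
   Context: All graphs are finite, undirected, simple and nontrivial (at least two vertices). The girth $g(G)$ is the length of a shortest cycle in $G$, $\Delta(G)$ is the maximum degree, and $N[v]=\{v\}\cup N(v)$ is the closed neighbourhood of $v$. For an integer $k\ge 1$, a set $B\subseteq V(G)$ is a $k$-limited packing if $|N[v]\cap B|\le k$ for every vertex $v$ of $G$; $L_k(G)$ is the maximum cardinality of a $k$-limited packing in $G$. *)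

theory Defs
  imports "Graph_Theory.Pair_Digraph"
begin

text \<open>
  The locale \<^locale>\<open>pair_graph\<close> describes finite simple undirected graphs: an edge
  \<open>uv\<close> is the pair of opposite arcs \<open>(u, v)\<close> and \<open>(v, u)\<close>, and there are no loops.
\<close>

definition nontrivial_graph :: "'a pair_pre_digraph \<Rightarrow> bool" where
  "nontrivial_graph G \<longleftrightarrow> pair_graph G \<and> 2 \<le> card (pverts G)"

text \<open>
  A directed cycle traverses an edge back and forth when it has length 2; the directed cycles
  of length at least 3 are exactly the oriented cycles of the undirected graph.
\<close>

definition graph_cycle :: "'a pair_pre_digraph \<Rightarrow> ('a \<times> 'a) list \<Rightarrow> bool" where
  "graph_cycle G p \<longleftrightarrow> pre_digraph.cycle (with_proj G) p \<and> 3 \<le> length p"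

definition contains_cycle :: "'a pair_pre_digraph \<Rightarrow> bool" where
  "contains_cycle G \<longleftrightarrow> (\<exists>p. graph_cycle G p)"

text \<open>The girth is unspecified for graphs without a cycle.\<close>

definition girth :: "'a pair_pre_digraph \<Rightarrow> nat" where
  "girth G = (LEAST n. \<exists>p. graph_cycle G p \<and> length p = n)"

definition nbhd :: "'a pair_pre_digraph \<Rightarrow> 'a \<Rightarrow> 'a set" where
  "nbhd G v = {u. (v, u) \<in> parcs G}"

definition closed_nbhd :: "'a pair_pre_digraph \<Rightarrow> 'a \<Rightarrow> 'a set" where
  "closed_nbhd G v = insert v (nbhd G v)"

definition max_degree :: "'a pair_pre_digraph \<Rightarrow> nat" where
  "max_degree G = Max ((\<lambda>v. card (nbhd G v)) ` pverts G)"

definition limited_packing :: "'a pair_pre_digraph \<Rightarrow> nat \<Rightarrow> 'a set \<Rightarrow> bool" where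
  "limited_packing G k B \<longleftrightarrow>
     B \<subseteq> pverts G \<and> (\<forall>v\<in>pverts G. card (closed_nbhd G v \<inter> B) \<le> k)"

definition limited_packing_number :: "nat \<Rightarrow> 'a pair_pre_digraph \<Rightarrow> nat" where
  "limited_packing_number k G = Max (card ` {B. limited_packing G k B})"

end

theory Submission
  imports Defs
begin

text \<open>
  A vertex \<open>v\<close> off a shortest cycle \<open>C\<close> with neighbours at positions \<open>i < j\<close> on \<open>C\<close> closes a
  cycle of length \<open>j - i + 2\<close>, so \<open>v\<close> has at most two neighbours on \<open>C\<close> once the girth is at
  least 4; and \<open>C\<close> has no chords. Hence \<open>C\<close> is a 3-limited packing, and adding \<open>k - 3\<close>
  arbitrary vertices gives a \<open>k\<close>-limited packing; the maximum degree guarantees that these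
  vertices exist. Deleting from \<open>C\<close> every third vertex, starting at position 0, leaves a
  2-limited packing. The complete graph on \<open>k + 1\<close> vertices attains both bounds
  (the first one for \<open>k = 2\<close>).
\<close>

section \<open>Cycles and girth\<close>

text \<open>Indices replace the recursion of \<open>pcas\<close>, so that the closing arc of a cycle
  can later be treated like every other arc.\<close>

lemma pcas_conv_nth:
  assumes "p \<noteq> []"
  shows "pcas u p v \<longleftrightarrow> fst (p ! 0) = u \<and> snd (p ! (length p - 1)) = v \<and>
    (\<forall>i. Suc i < length p \<longrightarrow> snd (p ! i) = fst (p ! Suc i))"
  using assms
proof (induction p arbitrary: u)
  case (Cons e p)
  show ?case
  proof (cases "p = []")
    case False
    have "(\<forall>i. Suc i < length (e # p) \<longrightarrow> snd ((e # p) ! i) = fst ((e # p) ! Suc i)) \<longleftrightarrow>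
      snd e = fst (p ! 0) \<and> (\<forall>i. Suc i < length p \<longrightarrow> snd (p ! i) = fst (p ! Suc i))"
      (is "?L \<longleftrightarrow> ?R")
    proof
      assume ?L
      then have "snd ((e # p) ! 0) = fst ((e # p) ! Suc 0)"
        and "\<And>i. Suc i < length p \<Longrightarrow> snd ((e # p) ! Suc i) = fst ((e # p) ! Suc (Suc i))"
        using False by (metis One_nat_def Suc_less_eq length_Cons length_greater_0_conv)+
      then show ?R by simp
    next
      assume ?R
      then show ?L using False by (auto simp: nth_Cons split: nat.splits)
    qed
    then show ?thesis using Cons.IH[OF False] False by auto
  qed auto
qed simp

text \<open>For a closed walk, the condition at the two ends is the consecutiveness condition at the
  last index once indices wrap around modulo the length. Thus the base vertex disappears, and the
  distinctness of the visited vertices after the first is that of \<open>map snd p\<close>.\<close>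

lemma (in pair_wf_digraph) graph_cycle_conv_nth:
  "graph_cycle G p \<longleftrightarrow> 3 \<le> length p \<and> set p \<subseteq> parcs G \<and> distinct (map snd p) \<and>
    (\<forall>i < length p. snd (p ! i) = fst (p ! (Suc i mod length p)))"
proof (cases "3 \<le> length p")
  case True
  then have ne: "p \<noteq> []" by auto
  have "cycle p \<longleftrightarrow> (\<exists>u. awalk u p u \<and> distinct (map snd p))"
    using ne by (auto simp: cycle_def awalk_verts_conv' awalk_def)
  also have "\<dots> \<longleftrightarrow> set p \<subseteq> parcs G \<and> distinct (map snd p) \<and> pcas (fst (p ! 0)) p (fst (p ! 0))"
  proof -
    have "fst (p ! 0) \<in> pverts G" if "set p \<subseteq> parcs G"
      using that ne by (intro arc_fst_in_verts) auto
    then show ?thesis using ne by (auto simp: awalk_def pcas_conv_nth)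
  qed
  also have "pcas (fst (p ! 0)) p (fst (p ! 0)) \<longleftrightarrow>
      (\<forall>i < length p. snd (p ! i) = fst (p ! (Suc i mod length p)))" (is "_ \<longleftrightarrow> ?R")
  proof
    assume L: "pcas (fst (p ! 0)) p (fst (p ! 0))"
    show ?R
    proof (intro allI impI)
      fix i assume "i < length p"
      then consider "Suc i < length p" | "Suc i = length p" by linarith
      then show "snd (p ! i) = fst (p ! (Suc i mod length p))"
      proof cases
        case 2
        then have "i = length p - 1" by simp
        with L 2 show ?thesis using ne by (simp add: pcas_conv_nth)
      qed (use L ne in \<open>simp add: pcas_conv_nth\<close>)
    qed
  next
    assume R: ?R
    have "snd (p ! (length p - 1)) = fst (p ! 0)"
      using R[rule_format, of "length p - 1"] ne by simp
    moreover have "snd (p ! i) = fst (p ! Suc i)" if "Suc i < length p" for i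
      using R[rule_format, of i] that by simp
    ultimately show "pcas (fst (p ! 0)) p (fst (p ! 0))" using ne by (simp add: pcas_conv_nth)
  qed
  finally show ?thesis using True by (simp add: graph_cycle_def)
qed (simp add: graph_cycle_def)

text \<open>Turns an injective enumeration of vertices into a cycle; together with
  \<open>girth_le\<close> it yields every lower bound on distances along a shortest cycle.\<close>

lemma (in pair_wf_digraph) graph_cycle_of_vertices:
  assumes "3 \<le> n" "inj_on c {..<n}"
    and "\<And>i. Suc i < n \<Longrightarrow> (c i, c (Suc i)) \<in> parcs G" "(c (n - 1), c 0) \<in> parcs G"
  shows "graph_cycle G (map (\<lambda>i. (c i, c (Suc i mod n))) [0..<n])"
proof -
  have "(c i, c (Suc i mod n)) \<in> parcs G" if "i < n" for i
  proof (cases "Suc i < n")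
    case False
    then have "i = n - 1" using that by simp
    then show ?thesis using assms(1,4) by simp
  qed (use assms(3) in simp)
  \<comment> \<open>Distinctness is required of the heads of the arcs, which are the vertices
    \<open>c\<close> shifted by one cyclically.\<close>
  moreover have "inj_on (\<lambda>i. c (Suc i mod n)) {0..<n}"
  proof (rule inj_onI)
    fix i j assume ij: "i \<in> {0..<n}" "j \<in> {0..<n}" "c (Suc i mod n) = c (Suc j mod n)"
    then have "Suc i mod n = Suc j mod n"
      using assms(1) by (intro inj_onD[OF assms(2)]) auto
    then show "i = j" using ij by (auto simp: mod_Suc split: if_splits)
  qed
  ultimately show ?thesis
    using assms(1) by (auto simp: graph_cycle_conv_nth distinct_map comp_def)
qed

lemma girth_le: "graph_cycle G p \<Longrightarrow> girth G \<le> length p"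
  unfolding girth_def by (rule Least_le) auto

lemma girth_attained:
  assumes "contains_cycle G"
  obtains p where "graph_cycle G p" "length p = girth G"
  using assms LeastI_ex[of "\<lambda>n. \<exists>p. graph_cycle G p \<and> length p = n"]
  unfolding contains_cycle_def girth_def by blast

section \<open>Shortest cycles\<close>

text \<open>A shortest cycle is encoded by its vertices in cyclic order. Only the values of
  \<open>c\<close> below the girth matter, and positions are taken modulo the girth.\<close>

locale shortest_cycle = pair_graph G for G :: "'a pair_pre_digraph" +
  fixes c :: "nat \<Rightarrow> 'a"
  assumes girth_ge3: "3 \<le> girth G"
    and inj_c: "inj_on c {..<girth G}"
    and arc_c: "\<And>i. i < girth G \<Longrightarrow> (c i, c (Suc i mod girth G)) \<in> parcs G"

lemma (in pair_graph) obtain_shortest_cycle: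
  assumes "contains_cycle G"
  obtains c where "shortest_cycle G c"
proof -
  obtain p where p: "graph_cycle G p" "length p = girth G"
    using girth_attained[OF assms] .
  let ?n = "girth G" and ?c = "\<lambda>i. fst (p ! i)"
  have n: "3 \<le> ?n" and arcs: "set p \<subseteq> parcs G" and dist: "distinct (map snd p)"
    using p by (auto simp: graph_cycle_conv_nth)
  have nxt: "snd (p ! i) = ?c (Suc i mod ?n)" if "i < ?n" for i
    using p that by (auto simp: graph_cycle_conv_nth)
  have "inj_on ?c {..<?n}"
  proof (rule inj_onI)
    fix i j assume ij: "i \<in> {..<?n}" "j \<in> {..<?n}" "?c i = ?c j"
    \<comment> \<open>These are the cyclic predecessors of \<open>i\<close> and \<open>j\<close>: a
      tail of an arc is the head of the preceding one, so distinct heads give distinct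
      tails.\<close>
    define i' j' where "i' = (i + (?n - 1)) mod ?n" and "j' = (j + (?n - 1)) mod ?n"
    have "Suc i' mod ?n = i" "Suc j' mod ?n = j" and lt: "i' < ?n" "j' < ?n"
      using ij p(2) n by (auto simp: i'_def j'_def mod_Suc_eq)
    then have "snd (p ! i') = snd (p ! j')" using nxt[of i'] nxt[of j'] ij by simp
    then have "i' = j'"
      using dist lt p(2) by (metis length_map nth_eq_iff_index_eq nth_map)
    then show "i = j" using \<open>Suc i' mod ?n = i\<close> \<open>Suc j' mod ?n = j\<close> by simp
  qed
  moreover have "(?c i, ?c (Suc i mod ?n)) \<in> parcs G" if "i < ?n" for i
    using arcs nxt[OF that] that p(2) by (metis nth_mem prod.collapse subsetD)
  ultimately have "shortest_cycle G ?c"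
    using n by unfold_locales auto
  then show ?thesis by (rule that)
qed

context shortest_cycle
begin

abbreviation "cycle_verts \<equiv> c ` {..<girth G}"

lemma arc_c_Suc: "Suc i < girth G \<Longrightarrow> (c i, c (Suc i)) \<in> parcs G"
  using arc_c[of i] by simp

lemma cycle_verts_subset: "cycle_verts \<subseteq> pverts G"
  using arc_c by (auto dest: in_arcsD1)

section \<open>Adjacency to a shortest cycle\<close>

text \<open>If \<open>j\<close> is not \<open>Suc i\<close>, the arc closes the segment from
  \<open>c i\<close> to \<open>c j\<close> to a cycle of length \<open>j - i + 1\<close>. Minimality
  forces the segment to be the whole cycle, so the arc joins its last vertex and its first.\<close>

lemma no_chord_aux:
  assumes "i < j" "j < girth G" "(c i, c j) \<in> parcs G"
  shows "j = Suc i mod girth G \<or> i = Suc j mod girth G"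
proof (cases "j = Suc i")
  case False
  let ?n = "Suc (j - i)"
  have "inj_on (\<lambda>t. c (i + t)) {..<?n}"
    using assms by (auto intro!: inj_onI dest!: inj_onD[OF inj_c])
  then have "graph_cycle G (map (\<lambda>t. (c (i + t), c (i + Suc t mod ?n))) [0..<?n])"
    using assms False
    by (intro graph_cycle_of_vertices) (auto intro: arc_c_Suc arcs_symmetric)
  from girth_le[OF this] have "i = 0" "Suc j = girth G" using assms by simp_all
  then show ?thesis by simp
qed (use assms in simp)

lemma no_chord:
  assumes "i < girth G" "j < girth G" "(c i, c j) \<in> parcs G"
  shows "j = Suc i mod girth G \<or> i = Suc j mod girth G"
proof -
  have "i \<noteq> j" using assms(3) no_loops' by auto
  then show ?thesis
    using no_chord_aux[of i j] no_chord_aux[of j i] assms arcs_symmetric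
    by (meson linorder_neqE_nat)
qed

lemma nbr_dist:
  assumes "v \<notin> cycle_verts" "i < j" "j < girth G" "(v, c i) \<in> parcs G" "(v, c j) \<in> parcs G"
  shows "girth G \<le> j - i + 2"
proof -
  let ?n = "j - i + 2"
  \<comment> \<open>The closed walk runs along the segment from \<open>c i\<close> to
    \<open>c j\<close> and ends at \<open>v\<close>, placed at the last index.\<close>
  define f where "f t = (if t = Suc (j - i) then v else c (i + t))" for t
  have "inj_on f {..<?n}"
  proof (rule inj_onI)
    fix s t assume st: "s \<in> {..<?n}" "t \<in> {..<?n}" "f s = f t"
    have "c (i + s) \<noteq> v" if "s \<le> j - i" for s using that assms(1-3) by auto
    then show "s = t"
      using st assms(2,3) inj_onD[OF inj_c, of "i + s" "i + t"]
      by (auto simp: f_def split: if_splits) (metis less_Suc_eq_le less_antisym)+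
  qed
  moreover have "(f t, f (Suc t)) \<in> parcs G" if "Suc t < ?n" for t
    using that assms by (cases "t = j - i") (auto simp: f_def intro: arc_c_Suc arcs_symmetric)
  moreover have "(f (?n - 1), f 0) \<in> parcs G" using assms(4) by (simp add: f_def)
  ultimately have "graph_cycle G (map (\<lambda>t. (f t, f (Suc t mod ?n))) [0..<?n])"
    using assms(2) by (intro graph_cycle_of_vertices) simp_all
  from girth_le[OF this] show ?thesis by simp
qed

text \<open>Three neighbours would leave two consecutive gaps of at least \<open>girth G - 2\<close>
  each, while all positions lie within a span of \<open>girth G - 1\<close>; this is impossible for
  girth at least 4.\<close>

lemma card_nbhd_off_cycle:
  assumes "v \<notin> cycle_verts" "4 \<le> girth G"
  shows "card (closed_nbhd G v \<inter> cycle_verts) \<le> 2"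
proof -
  let ?I = "{i. i < girth G \<and> (v, c i) \<in> parcs G}"
  \<comment> \<open>For empty \<open>?I\<close> both extremes are unspecified, but the inclusion is
    trivial; otherwise a third position would lie strictly between them.\<close>
  have "?I \<subseteq> {Min ?I, Max ?I}"
  proof (rule ccontr)
    assume "\<not> ?I \<subseteq> {Min ?I, Max ?I}"
    then obtain i where i: "i \<in> ?I" "i \<noteq> Min ?I" "i \<noteq> Max ?I" by blast
    then have "?I \<noteq> {}" by blast
    moreover have "finite ?I" by simp
    ultimately have mem: "Min ?I \<in> ?I" "Max ?I \<in> ?I"
      using Min_in[of ?I] Max_in[of ?I] by blast+
    have "Min ?I \<le> i" "i \<le> Max ?I" using i(1) by simp_all
    with i have lt: "Min ?I < i" "i < Max ?I" by linarith+
    have "girth G \<le> i - Min ?I + 2" "girth G \<le> Max ?I - i + 2"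
      by (rule nbr_dist[OF assms(1)]; use i(1) mem lt in blast)+
    moreover have "Max ?I < girth G" using mem by simp
    ultimately show False using assms(2) lt by linarith
  qed
  then have "card ?I \<le> card {Min ?I, Max ?I}" by (intro card_mono) auto
  also have "\<dots> \<le> 2" using card_insert_le_m1[of 2 "{Max ?I}"] by simp
  finally have "card ?I \<le> 2" .
  moreover have "closed_nbhd G v \<inter> cycle_verts = c ` ?I"
    using assms(1) by (auto simp: closed_nbhd_def nbhd_def)
  ultimately show ?thesis using card_image_le[of ?I c] by simp
qed

text \<open>One inclusion is the absence of chords, the other comes from the arcs of the cycle. The
  predecessor of \<open>m\<close> is described as the \<open>j\<close> whose successor is
  \<open>m\<close>, which avoids a case for position 0.\<close>

lemma nbhd_on_cycle:
  assumes "m < girth G"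
  shows "closed_nbhd G (c m) \<inter> cycle_verts =
    c ` {j. j < girth G \<and> (j = m \<or> j = Suc m mod girth G \<or> m = Suc j mod girth G)}"
  using assms no_chord arc_c arcs_symmetric by (auto simp: closed_nbhd_def nbhd_def)

lemma card_nbhd_on_cycle:
  assumes "v \<in> cycle_verts"
  shows "card (closed_nbhd G v \<inter> cycle_verts) \<le> 3"
proof -
  obtain m where m: "v = c m" "m < girth G" using assms by auto
  let ?J = "{j. j < girth G \<and> (j = m \<or> j = Suc m mod girth G \<or> m = Suc j mod girth G)}"
  have "?J \<subseteq> {m, Suc m mod girth G, if m = 0 then girth G - 1 else m - 1}"
    by (auto simp: mod_Suc split: if_splits)
  then have "card ?J \<le> card {m, Suc m mod girth G, if m = 0 then girth G - 1 else m - 1}"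
    by (intro card_mono) auto
  also have "card {x, y, z} \<le> 3" for x y z :: nat by (simp add: card_insert_if)
  finally show ?thesis
    using m nbhd_on_cycle card_image_le[of ?J c] by simp
qed

section \<open>Limited packings inside a shortest cycle\<close>

text \<open>Girth 3 is treated apart: a vertex off a triangle may be adjacent to all of it, but the
  triangle has only three vertices.\<close>

lemma limited_packing_cycle: "limited_packing G 3 cycle_verts"
proof -
  have "card (closed_nbhd G v \<inter> cycle_verts) \<le> 3" for v
  proof -
    consider "v \<in> cycle_verts" | "v \<notin> cycle_verts" "4 \<le> girth G" | "girth G = 3"
      using girth_ge3 by linarith
    then show ?thesis
    proof cases
      case 3
      have "card (closed_nbhd G v \<inter> cycle_verts) \<le> card cycle_verts"
        by (rule card_mono) auto
      also have "\<dots> \<le> 3" using card_image_le[of "{..<girth G}" c] 3 by simp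
      finally show ?thesis .
    qed (use card_nbhd_on_cycle card_nbhd_off_cycle[of v] in auto)
  qed
  then show ?thesis using cycle_verts_subset by (simp add: limited_packing_def)
qed

text \<open>A closed neighbourhood centred on the cycle meets the cycle in at most three vertices,
  and at least one of them is deleted. Off the cycle the bound 2 holds already for the whole cycle,
  and for girth 3 only two vertices remain.\<close>

lemma limited_packing_two_thirds:
  "limited_packing G 2 (c ` {i. i < girth G \<and> i mod 3 \<noteq> 0})" (is "limited_packing G 2 ?B")
proof -
  have sub: "?B \<subseteq> cycle_verts" by auto
  have "card (closed_nbhd G v \<inter> ?B) \<le> 2" for v
  proof -
    consider "v \<in> cycle_verts" | "v \<notin> cycle_verts" "4 \<le> girth G" | "girth G = 3"
      using girth_ge3 by linarith
    then show ?thesis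
    proof cases
      case 1
      then obtain m where m: "v = c m" "m < girth G" by auto
      let ?n = "girth G"
      have "\<exists>j < ?n. j mod 3 = 0 \<and> (j = m \<or> j = Suc m mod ?n \<or> m = Suc j mod ?n)"
      proof -
        \<comment> \<open>A deleted position is \<open>m\<close> itself or a cyclic neighbour of it.
          The last position needs its own case: its successor wraps around to position 0, which is
          deleted whatever the girth is modulo 3.\<close>
        consider "m mod 3 = 0" | "m mod 3 = 1" | "m mod 3 = 2" "Suc m < ?n" | "Suc m = ?n"
          using m(2) by linarith
        then show ?thesis
        proof cases
          case 2
          then have "(m - 1) mod 3 = 0" "Suc (m - 1) = m" by presburger+
          then show ?thesis using m(2) by (intro exI[of _ "m - 1"]) auto
        next
          case 3
          then have "Suc m mod 3 = 0" by presburger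
          then show ?thesis using 3 by (intro exI[of _ "Suc m"]) auto
        next
          case 4
          then show ?thesis by (intro exI[of _ 0]) auto
        qed (use m(2) in auto)
      qed
      then obtain j where j: "j < ?n" "j mod 3 = 0"
        and "j = m \<or> j = Suc m mod ?n \<or> m = Suc j mod ?n"
        by (elim exE conjE) (rule that)
      then have mem: "c j \<in> closed_nbhd G v \<inter> cycle_verts"
        unfolding m(1) nbhd_on_cycle[OF m(2)] by (intro imageI) simp
      have "c j \<notin> ?B"
      proof
        assume "c j \<in> ?B"
        then obtain i where i: "c j = c i" "i < ?n" "i mod 3 \<noteq> 0" by blast
        then have "j = i" using inj_onD[OF inj_c, of j i] j(1) by simp
        with i(3) j(2) show False by simp
      qed
      then have "closed_nbhd G v \<inter> ?B \<subset> closed_nbhd G v \<inter> cycle_verts"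
        using mem sub by blast
      then have "card (closed_nbhd G v \<inter> ?B) < card (closed_nbhd G v \<inter> cycle_verts)"
        by (intro psubset_card_mono) auto
      then show ?thesis using card_nbhd_on_cycle[of v] 1 by simp
    next
      case 2
      have "card (closed_nbhd G v \<inter> ?B) \<le> card (closed_nbhd G v \<inter> cycle_verts)"
        using sub by (intro card_mono) auto
      then show ?thesis using card_nbhd_off_cycle[OF 2] by simp
    next
      case 3
      have "{i. i < 3 \<and> i mod 3 \<noteq> 0} = {1, 2::nat}" by auto
      then have "?B = {c 1, c 2}" using 3 by simp
      moreover have "card (closed_nbhd G v \<inter> {c 1, c 2}) \<le> card {c 1, c 2}"
        by (rule card_mono) auto
      moreover have "card {c 1, c 2} \<le> 2" by (simp add: card_insert_if)
      ultimately show ?thesis by simp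
    qed
  qed
  then show ?thesis using sub cycle_verts_subset by (auto simp: limited_packing_def)
qed

end

section \<open>The lower bounds\<close>

context pair_graph
begin

lemma finite_limited_packings: "finite {B. limited_packing G k B}"
  by (rule finite_subset[of _ "Pow (pverts G)"]) (auto simp: limited_packing_def)

lemma card_le_limited_packing_number:
  "limited_packing G k B \<Longrightarrow> card B \<le> limited_packing_number k G"
  unfolding limited_packing_number_def by (rule Max_ge) (auto simp: finite_limited_packings)

lemma nbhd_subset: "nbhd G v \<subseteq> pverts G"
  by (auto simp: nbhd_def dest: in_arcsD2)

text \<open>Each vertex of \<open>D\<close> raises the count in any closed neighbourhood by at most
  one.\<close>

lemma limited_packing_union:
  assumes "limited_packing G k B" "D \<subseteq> pverts G"
  shows "limited_packing G (k + card D) (B \<union> D)"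
proof -
  have "finite D" using assms(2) finite_subset pair_finite_verts by blast
  have "card (closed_nbhd G v \<inter> (B \<union> D)) \<le> k + card D" if "v \<in> pverts G" for v
  proof -
    have "card (closed_nbhd G v \<inter> (B \<union> D)) \<le>
        card (closed_nbhd G v \<inter> B) + card (closed_nbhd G v \<inter> D)"
      by (simp add: Int_Un_distrib card_Un_le)
    also have "card (closed_nbhd G v \<inter> D) \<le> card D"
      using \<open>finite D\<close> by (intro card_mono) auto
    also have "card (closed_nbhd G v \<inter> B) \<le> k"
      using assms(1) that by (simp add: limited_packing_def)
    finally show ?thesis by simp
  qed
  then show ?thesis using assms by (simp add: limited_packing_def)
qed

end

text \<open>Passing from \<open>n\<close> to \<open>Suc n\<close>, the value
  \<open>(2 * n) div 3\<close> stays the same exactly when 3 divides \<open>n\<close>, which is when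
  the new index is left out of the set.\<close>

lemma card_not_dvd_3: "card {i. i < n \<and> i mod 3 \<noteq> (0::nat)} = (2 * n) div 3"
proof (induction n)
  case (Suc n)
  have "{i. i < Suc n \<and> i mod 3 \<noteq> 0} =
    (if n mod 3 = 0 then {i. i < n \<and> i mod 3 \<noteq> 0} else insert n {i. i < n \<and> i mod 3 \<noteq> 0})"
    by (auto simp: less_Suc_eq)
  then have "card {i. i < Suc n \<and> i mod 3 \<noteq> 0} = (2 * n) div 3 + (if n mod 3 = 0 then 0 else 1)"
    using Suc by simp
  also have "\<dots> = (2 * Suc n) div 3" by (simp, presburger)
  finally show ?case .
qed simp

context shortest_cycle
begin

lemma two_thirds_girth_le: "(2 * girth G) div 3 \<le> limited_packing_number 2 G"
proof -
  have "card (c ` {i. i < girth G \<and> i mod 3 \<noteq> 0}) = (2 * girth G) div 3"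
    using card_image[OF inj_on_subset[OF inj_c]] card_not_dvd_3[of "girth G"]
    by (metis (mono_tags, lifting) lessThan_iff mem_Collect_eq subsetI)
  then show ?thesis using card_le_limited_packing_number[OF limited_packing_two_thirds] by simp
qed

text \<open>The \<open>k - 3\<close> extra vertices are found in the closed neighbourhood of a
  vertex of maximum degree: it has at least \<open>k + 1\<close> elements, of which at most three
  lie on the cycle.\<close>

lemma girth_plus_le:
  assumes "pverts G \<noteq> {}" "k \<le> max_degree G" "3 \<le> k"
  shows "girth G + k - 3 \<le> limited_packing_number k G"
proof -
  have "max_degree G \<in> (\<lambda>v. card (nbhd G v)) ` pverts G"
    unfolding max_degree_def using assms(1) by (intro Max_in) auto
  then obtain v where v: "v \<in> pverts G" "k \<le> card (nbhd G v)" using assms(2) by auto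
  have "finite (nbhd G v)" using nbhd_subset pair_finite_verts finite_subset by blast
  moreover have "v \<notin> nbhd G v" using no_loops' by (auto simp: nbhd_def)
  ultimately have "k + 1 \<le> card (closed_nbhd G v)"
    and fin: "finite (closed_nbhd G v)" using v by (simp_all add: closed_nbhd_def)
  moreover have "card (closed_nbhd G v \<inter> cycle_verts) \<le> 3"
    using limited_packing_cycle v(1) by (simp add: limited_packing_def)
  ultimately have "k - 3 \<le> card (closed_nbhd G v - cycle_verts)"
    by (simp add: card_Diff_subset_Int)
  then obtain D where D: "D \<subseteq> closed_nbhd G v - cycle_verts" "card D = k - 3"
    by (metis obtain_subset_with_card_n)
  then have "finite D" using fin finite_subset by blast
  then have "card (cycle_verts \<union> D) = girth G + (k - 3)"
    using D card_image[OF inj_c] by (subst card_Un_disjoint) auto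
  moreover have "limited_packing G (3 + card D) (cycle_verts \<union> D)"
    using D v(1) nbhd_subset
    by (intro limited_packing_union limited_packing_cycle) (auto simp: closed_nbhd_def)
  ultimately show ?thesis
    using card_le_limited_packing_number[of "3 + card D"] D(2) assms(3) by fastforce
qed

end

section \<open>Complete graphs\<close>

definition complete_graph :: "nat \<Rightarrow> nat pair_pre_digraph" where
  "complete_graph n = \<lparr>pverts = {..<n}, parcs = {(i, j). i < n \<and> j < n \<and> i \<noteq> j}\<rparr>"

lemma complete_graph_simps [simp]:
  "pverts (complete_graph n) = {..<n}"
  "(i, j) \<in> parcs (complete_graph n) \<longleftrightarrow> i < n \<and> j < n \<and> i \<noteq> j"
  by (auto simp: complete_graph_def)

lemma pair_graph_complete_graph: "pair_graph (complete_graph n)"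
proof
  show "finite (parcs (complete_graph n))"
    by (rule finite_subset[of _ "{..<n} \<times> {..<n}"]) (auto simp: complete_graph_def)
  show "symmetric (complete_graph n)" by (auto simp: symmetric_def sym_def)
qed (auto simp: complete_graph_def)

lemma closed_nbhd_complete_graph: "v < n \<Longrightarrow> closed_nbhd (complete_graph n) v = {..<n}"
  by (auto simp: closed_nbhd_def nbhd_def)

text \<open>The vertices 0, 1, 2 form a triangle, and no cycle is shorter because
  \<open>graph_cycle\<close> demands length at least 3.\<close>

lemma
  assumes "3 \<le> n"
  shows contains_cycle_complete_graph: "contains_cycle (complete_graph n)"
    and girth_complete_graph: "girth (complete_graph n) = 3"
proof -
  interpret pair_graph "complete_graph n" by (rule pair_graph_complete_graph)
  have *: "graph_cycle (complete_graph n) (map (\<lambda>i. (id i, id (Suc i mod 3))) [0..<3])"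
    using assms by (intro graph_cycle_of_vertices) auto
  then show cyc: "contains_cycle (complete_graph n)" by (auto simp: contains_cycle_def)
  show "girth (complete_graph n) = 3"
    using girth_le[OF *] girth_attained[OF cyc] by (force simp: graph_cycle_def)
qed

lemma max_degree_complete_graph: "max_degree (complete_graph (Suc k)) = k"
proof -
  have "nbhd (complete_graph (Suc k)) v = {..<Suc k} - {v}" if "v < Suc k" for v
    using that by (auto simp: nbhd_def)
  then have "(\<lambda>v. card (nbhd (complete_graph (Suc k)) v)) ` {..<Suc k} = {k}" by force
  then show ?thesis by (simp add: max_degree_def)
qed

text \<open>Every closed neighbourhood is the whole vertex set, so the \<open>k\<close>-limited
  packings are the sets of at most \<open>k\<close> vertices.\<close>

lemma limited_packing_number_complete_graph:
  assumes "k < n"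
  shows "limited_packing_number k (complete_graph n) = k"
proof -
  interpret pair_graph "complete_graph n" by (rule pair_graph_complete_graph)
  have iff: "limited_packing (complete_graph n) k B \<longleftrightarrow> B \<subseteq> {..<n} \<and> card B \<le> k" for B
    using assms
    by (auto simp: limited_packing_def closed_nbhd_complete_graph Int_absorb1 Ball_def)
  have "card {..<k} \<le> limited_packing_number k (complete_graph n)"
    using assms by (intro card_le_limited_packing_number) (auto simp: iff)
  moreover have "limited_packing_number k (complete_graph n) \<le> k"
    unfolding limited_packing_number_def
    by (intro Max.boundedI finite_imageI finite_limited_packings) (auto simp: iff)
  ultimately show ?thesis by simp
qed

theorem theorem3p8:
  shows "(\<forall>G :: 'a pair_pre_digraph. nontrivial_graph G \<and> contains_cycle G \<longrightarrow>
            limited_packing_number 2 G \<ge> (2 * girth G) div 3 \<and>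
            (\<forall>k. max_degree G \<ge> k \<and> k \<ge> 3 \<longrightarrow>
               limited_packing_number k G \<ge> girth G + k - 3)) \<and>
         (\<exists>G :: nat pair_pre_digraph. nontrivial_graph G \<and> contains_cycle G \<and>
            limited_packing_number 2 G = (2 * girth G) div 3) \<and>
         (\<forall>k \<ge> 3. \<exists>G :: nat pair_pre_digraph. nontrivial_graph G \<and> contains_cycle G \<and>
            max_degree G \<ge> k \<and> limited_packing_number k G = girth G + k - 3)"
proof (intro conjI)
  show "\<forall>G :: 'a pair_pre_digraph. nontrivial_graph G \<and> contains_cycle G \<longrightarrow>
            limited_packing_number 2 G \<ge> (2 * girth G) div 3 \<and>
            (\<forall>k. max_degree G \<ge> k \<and> k \<ge> 3 \<longrightarrow>
               limited_packing_number k G \<ge> girth G + k - 3)"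
  proof (intro allI impI, elim conjE)
    fix G :: "'a pair_pre_digraph"
    assume G: "nontrivial_graph G" "contains_cycle G"
    interpret pair_graph G using G(1) by (simp add: nontrivial_graph_def)
    obtain c where "shortest_cycle G c" using obtain_shortest_cycle[OF G(2)] .
    then interpret shortest_cycle G c .
    have "pverts G \<noteq> {}" using G(1) by (auto simp: nontrivial_graph_def)
    then show "limited_packing_number 2 G \<ge> (2 * girth G) div 3 \<and>
            (\<forall>k. max_degree G \<ge> k \<and> k \<ge> 3 \<longrightarrow>
               limited_packing_number k G \<ge> girth G + k - 3)"
      using two_thirds_girth_le girth_plus_le by blast
  qed
  have nontriv: "nontrivial_graph (complete_graph (Suc k))" if "2 \<le> k" for k
    using that by (simp add: nontrivial_graph_def pair_graph_complete_graph)
  show "\<exists>G :: nat pair_pre_digraph. nontrivial_graph G \<and> contains_cycle G \<and>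
            limited_packing_number 2 G = (2 * girth G) div 3"
    using nontriv[of 2]
    \<comment> \<open>The witness is the triangle, where both sides equal 2.\<close>
    by (intro exI[of _ "complete_graph (Suc 2)"])
      (simp add: contains_cycle_complete_graph girth_complete_graph
        limited_packing_number_complete_graph)
  show "\<forall>k \<ge> 3. \<exists>G :: nat pair_pre_digraph. nontrivial_graph G \<and> contains_cycle G \<and>
            max_degree G \<ge> k \<and> limited_packing_number k G = girth G + k - 3"
  proof (intro allI impI)
    fix k :: nat assume "3 \<le> k"
    then show "\<exists>G :: nat pair_pre_digraph. nontrivial_graph G \<and> contains_cycle G \<and>
            max_degree G \<ge> k \<and> limited_packing_number k G = girth G + k - 3"
      using nontriv[of k]
      \<comment> \<open>With \<open>k + 1\<close> vertices the maximum degree is exactly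
        \<open>k\<close>, and girth 3 makes the right-hand side equal to \<open>k\<close>.\<close>
      by (intro exI[of _ "complete_graph (Suc k)"])
        (simp add: contains_cycle_complete_graph girth_complete_graph max_degree_complete_graph
          limited_packing_number_complete_graph)
  qed
qed

end
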